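(* Let $m\ge2$. A regular $(n,m,k,\lambda)$-EDF forms an $(n,m,K=(k,k,\dots,k),a=mk,\lambda)$-SWEDF.
   Context: Let $G$ be an additive Abelian group of order $n$ with identity $0$. For multi-sets $B_1,B_2$ of elements of $G$, $D(B_1,B_2)$ is the multi-set $\{x-y : x\in B_1,\ y\in B_2\}$; $c\boxtimes B$ is the multi-set in which each element of $B$ is repeated $c$ times; unions are multi-set unions. Let $\mathcal{B}=\{B_i : 1\le i\le m\}$ be a family of pairwise disjoint nonempty subsets of $G$ with $k_i=|B_i|$. $\mathcal{B}$ is an external difference family (EDF) if $\bigcup_{1\le i\ne j\le m}D(B_i,B_j)=\lambda\boxtimes(G\setminus\{0\})$; it is a regular $(n,m,k,\lambda)$-EDF if moreover $k_1=\dots=k_m=k$. With $K=(k_1,\dots,k_m)$, $a=\sum_i k_i$, $\widetilde{k}=\mathrm{lcm}(k_1,\dots,k_m)$ and $\widetilde{B}_i=\frac{\widetilde{k}}{k_i}\boxtimes B_i$, $\mathcal{B}$ is an $(n,m,K,a,\lambda)$-SWEDF (standard weighted external difference family), $\lambda$ a positive integer, if $\bigcup_{1\le i\ne j\le m}D(B_i,\widetilde{B}_j)=\lambda\boxtimes(G\setminus\{0\})$. *)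

theory Defs
  imports Main "HOL-Library.Multiset" "HOL-Library.Disjoint_Sets"
begin

definition diff_mset :: "'a::ab_group_add multiset \<Rightarrow> 'a multiset \<Rightarrow> 'a multiset" where
  "diff_mset B1 B2 = (\<Sum>x\<in>#B1. {#x - y. y \<in># B2#})"

definition nonzero_mset :: "'a::{ab_group_add,finite} multiset" where
  "nonzero_mset = mset_set (UNIV - {0})"

text \<open>A family \<open>B\<close> of length \<open>m\<close> is a function on the naturals of which only the
  values on \<open>{1..m}\<close> matter; likewise for the tuple of block sizes.\<close>

definition block_family :: "nat \<Rightarrow> (nat \<Rightarrow> 'a set) \<Rightarrow> bool" where
  "block_family m B \<longleftrightarrow> (\<forall>i\<in>{1..m}. B i \<noteq> {}) \<and> disjoint_family_on B {1..m}"

text \<open>For external difference families \<open>l\<close> is only required to be a natural number; for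
  standard weighted ones, below, it must be positive.\<close>

definition EDF :: "nat \<Rightarrow> nat \<Rightarrow> (nat \<Rightarrow> 'a::{ab_group_add,finite} set) \<Rightarrow> bool" where
  "EDF m l B \<longleftrightarrow>
     block_family m B \<and>
     (\<Sum>(i, j) \<in> {(i, j). i \<in> {1..m} \<and> j \<in> {1..m} \<and> i \<noteq> j}.
        diff_mset (mset_set (B i)) (mset_set (B j))) = repeat_mset l nonzero_mset"

definition regular_EDF ::
    "nat \<Rightarrow> nat \<Rightarrow> nat \<Rightarrow> nat \<Rightarrow> (nat \<Rightarrow> 'a::{ab_group_add,finite} set) \<Rightarrow> bool" where
  "regular_EDF n m k l B \<longleftrightarrow>
     card (UNIV :: 'a set) = n \<and> EDF m l B \<and> (\<forall>i\<in>{1..m}. card (B i) = k)"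

text \<open>The division below is exact, since each block size divides the least common multiple.\<close>

definition weighted_block :: "nat \<Rightarrow> (nat \<Rightarrow> 'a set) \<Rightarrow> nat \<Rightarrow> 'a multiset" where
  "weighted_block m B j =
     repeat_mset ((LCM i\<in>{1..m}. card (B i)) div card (B j)) (mset_set (B j))"

definition SWEDF ::
    "nat \<Rightarrow> nat \<Rightarrow> (nat \<Rightarrow> nat) \<Rightarrow> nat \<Rightarrow> nat \<Rightarrow> (nat \<Rightarrow> 'a::{ab_group_add,finite} set) \<Rightarrow> bool" where
  "SWEDF n m K a l B \<longleftrightarrow>
     card (UNIV :: 'a set) = n \<and>
     block_family m B \<and>
     (\<forall>i\<in>{1..m}. card (B i) = K i) \<and>
     a = (\<Sum>i\<in>{1..m}. K i) \<and>
     0 < l \<and>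
     (\<Sum>(i, j) \<in> {(i, j). i \<in> {1..m} \<and> j \<in> {1..m} \<and> i \<noteq> j}.
        diff_mset (mset_set (B i)) (weighted_block m B j)) = repeat_mset l nonzero_mset"

end

theory Submission
  imports Defs
begin

text \<open>If all blocks have size \<open>k\<close>, the lcm of the sizes is \<open>k\<close>, so
  every weight is \<open>k div k = 1\<close> and the SWEDF equation is the EDF equation itself
  (\<open>weighted_block_uniform\<close>). What remains is \<lambda> > 0, which \<open>EDF\<close>
  does not demand: two distinct nonempty blocks already yield a difference
  (\<open>EDF_index_pos\<close>).\<close>

lemma size_diff_mset: "size (diff_mset A B) = size A * size B"
  unfolding diff_mset_def by (induction A) auto

lemma weighted_block_uniform:
  fixes B :: "nat \<Rightarrow> 'a::finite set"
  assumes card: "\<forall>i\<in>{1..m}. card (B i) = k" and "j \<in> {1..m}" and "k > 0"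
  shows "weighted_block m B j = mset_set (B j)"
proof -
  \<comment> \<open>The index \<open>j\<close> shows that the range is nonempty; otherwise the image
    would be empty and its lcm 1.\<close>
  have "(\<lambda>i. card (B i)) ` {1..m} = {k}"
    using assms by force
  then have "(LCM i\<in>{1..m}. card (B i)) = k"
    by simp
  then show ?thesis
    using assms by (simp add: weighted_block_def)
qed

text \<open>For \<open>l = 0\<close> the total multiset of differences would be empty, yet the pair
  (1, 2), available since \<open>m \<ge> 2\<close>, contributes
  \<open>card (B 1) * card (B 2) > 0\<close> elements.\<close>

lemma EDF_index_pos:
  fixes B :: "nat \<Rightarrow> 'a::{ab_group_add,finite} set"
  assumes "m \<ge> 2" and edf: "EDF m l B"
  shows "0 < l"
proof (rule ccontr)
  let ?P = "{(i, j). i \<in> {1..m} \<and> j \<in> {1..m} \<and> i \<noteq> j}"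
  let ?f = "\<lambda>(i, j). diff_mset (mset_set (B i)) (mset_set (B j))"
  assume "\<not> 0 < l"
  then have sum0: "sum ?f ?P = {#}"
    using edf by (simp add: EDF_def)
  have fin: "finite ?P"
    by (rule finite_subset[of _ "{1..m} \<times> {1..m}"]) auto
  have mem: "(1, 2) \<in> ?P"
    using \<open>m \<ge> 2\<close> by auto
  have "sum ?f ?P = ?f (1, 2) + sum ?f (?P - {(1, 2)})"
    using fin mem by (rule sum.remove)
  \<comment> \<open>Multiset union cannot cancel, so an empty sum has only empty summands.\<close>
  then have "diff_mset (mset_set (B 1)) (mset_set (B 2)) = {#}"
    using sum0 by simp
  then have "card (B 1) * card (B 2) = 0"
    by (metis size_diff_mset size_empty size_mset_set)
  moreover have "B 1 \<noteq> {}" "B 2 \<noteq> {}"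
    using \<open>m \<ge> 2\<close> edf by (auto simp: EDF_def block_family_def)
  ultimately show False
    by simp
qed

theorem lemma4:
  fixes B :: "nat \<Rightarrow> 'a::{ab_group_add,finite} set"
    and n m k l :: nat
  assumes "m \<ge> 2"
    and "regular_EDF n m k l B"
  shows "SWEDF n m (\<lambda>i. k) (m * k) l B"
proof -
  let ?P = "{(i, j). i \<in> {1..m} \<and> j \<in> {1..m} \<and> i \<noteq> j}"
  have edf: "EDF m l B" and card: "\<forall>i\<in>{1..m}. card (B i) = k"
    and n: "card (UNIV :: 'a set) = n"
    using assms(2) by (auto simp: regular_EDF_def)
  \<comment> \<open>A nonempty block forces \<open>k > 0\<close>, so that \<open>k div k\<close> is
    1 and not the default \<open>0 div 0 = 0\<close>.\<close>
  have "B 1 \<noteq> {}" "card (B 1) = k"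
    using \<open>m \<ge> 2\<close> edf card by (auto simp: EDF_def block_family_def)
  then have "k > 0"
    by (metis card_gt_0_iff finite)
  have "(\<Sum>(i, j)\<in>?P. diff_mset (mset_set (B i)) (weighted_block m B j))
      = (\<Sum>(i, j)\<in>?P. diff_mset (mset_set (B i)) (mset_set (B j)))"
    by (rule sum.cong) (auto simp: weighted_block_uniform[OF card _ \<open>k > 0\<close>])
  with edf card n EDF_index_pos[OF \<open>m \<ge> 2\<close> edf] show ?thesis
    by (simp add: SWEDF_def EDF_def)
qed

end
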